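(* Let $\mathbf{d}=d_0d_1d_2\cdots\in\{-1,1\}^{\infty}$. Then $\mathbf{d}$ is apwenian if and only if \[\forall\, n\geq 0,\quad \frac{d_n+d_{n+1}-d_{2n+1}-d_{2n+2}}{2}\equiv 1\pmod{2}.\]
   Context: For a sequence $\mathbf{a}=a_0a_1a_2\cdots$ of integers and $n\geq 1$, the Hankel determinant of order $n$ is $H_n(\mathbf{a})=\det(a_{i+j})_{0\leq i,j\leq n-1}$. A sequence $\mathbf{d}\in\{-1,1\}^{\infty}$ is called apwenian if for all $n\geq 1$, $H_n(\mathbf{d})/2^{n-1}\equiv 1\pmod 2$. *)

theory Defs
  imports "Jordan_Normal_Form.Determinant" "HOL-Number_Theory.Cong"
begin

definition hankel_det :: "(nat \<Rightarrow> int) \<Rightarrow> nat \<Rightarrow> int" where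
  "hankel_det a n = det (mat n n (\<lambda>(i, j). a (i + j)))"

(* The division is exact: subtracting the first row of a matrix with entries in {-1, 1}
   from the other n - 1 rows makes all entries of those rows even. *)
definition apwenian :: "(nat \<Rightarrow> int) \<Rightarrow> bool" where
  "apwenian d \<longleftrightarrow>
     (\<forall>n. d n \<in> {-1, 1}) \<and>
     (\<forall>n\<ge>1. [hankel_det d n div 2 ^ (n - 1) = 1] (mod 2))"

end

theory Submission
  imports Defs "HOL-Library.Z2" "HOL-Computational_Algebra.Polynomial_FPS"
begin

text \<open>Modulo 2, row and column differences turn \<open>H\<^sub>n\<^sub>+\<^sub>1(d) / 2\<^sup>n\<close> into the order \<open>n\<close> Hankel
  determinant of \<open>s\<^sub>k = c\<^sub>k + c\<^sub>k\<^sub>+\<^sub>1\<close>, where \<open>c\<^sub>k = (d\<^sub>k\<^sub>+\<^sub>1 - d\<^sub>k) / 2\<close>, and the condition on \<open>d\<close> becomes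
  \<open>s\<^sub>0 = 1\<close>, \<open>s\<^sub>2\<^sub>k\<^sub>+\<^sub>2 = s\<^sub>2\<^sub>k\<^sub>+\<^sub>1 + s\<^sub>k\<close>. Over the field with two elements this recurrence says that
  the generating function \<open>f\<close> of \<open>s\<close> solves the Riccati equation
  \<open>(x + x\<^sup>2) f' + f + 1 + x\<^sup>2 f\<^sup>2 = 0\<close>. A kernel vector of a Hankel matrix yields a rational function
  \<open>u / v\<close> so close to \<open>f\<close> that, for degree reasons, it solves the equation exactly, which is
  impossible; hence all determinants are odd. Conversely, when the order \<open>n\<close> determinant is odd, the
  parity of the order \<open>n + 1\<close> determinant determines \<open>s\<^sub>2\<^sub>n\<close> from the earlier terms, so the
  recurrence is the only possibility.\<close>

section \<open>Arithmetic in the field with two elements\<close>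

declare add_bit_eq_xor [simp del] mult_bit_eq_and [simp del] power_bit_unfold [simp del]
  minus_bit_def [simp del]

lemma bit_add_self [simp]: "x + x = (0::bit)"
  by (cases x) (auto simp: add_bit_eq_xor)

lemma bit_add_left_self [simp]: "x + (x + y) = (y::bit)"
  by (simp flip: add.assoc)

lemma bit_minus_eq_add: "x - y = x + (y::bit)"
  by (simp add: minus_bit_def)

lemma bit_mult_self [simp]: "x * x = (x::bit)"
  by (cases x) auto

lemma bit_add_eq_0_iff [simp]: "x + y = 0 \<longleftrightarrow> x = (y::bit)"
  by (cases x; cases y) auto

lemma of_int_bit_eq_1_iff: "(of_int k :: bit) = 1 \<longleftrightarrow> odd k"
proof (cases "even k")
  case True
  then obtain j where "k = 2 * j" ..
  then show ?thesis by simp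
next
  case False
  then obtain j where "k = 2 * j + 1" ..
  then show ?thesis by simp
qed

lemma of_nat_bit: "(of_nat k :: bit) = of_bool (odd k)"
  using of_int_bit_eq_1_iff[of "int k"] by (cases "odd k") auto

section \<open>Formal power series: order of vanishing, and squares in characteristic two\<close>

lemma fps_X_power_dvd_iff_nth:
  fixes f :: "'a::comm_ring_1 fps"
  shows "fps_X ^ n dvd f \<longleftrightarrow> (\<forall>i<n. fps_nth f i = 0)"
proof
  assume "\<forall>i<n. fps_nth f i = 0"
  then have "f = fps_X ^ n * fps_shift n f"
    by (auto simp: fps_eq_iff fps_X_power_mult_nth)
  then show "fps_X ^ n dvd f" by (metis dvd_triv_left)
qed (auto simp: dvd_def fps_X_power_mult_nth)

text \<open>Differentiation may lower the order of vanishing at 0 by one; the factor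
  \<open>fps_X\<close> restores it.\<close>

lemma fps_X_power_dvd_X_mult_deriv:
  fixes f :: "'a::comm_ring_1 fps"
  assumes "fps_X ^ n dvd f"
  shows "fps_X ^ n dvd fps_X * fps_deriv f"
  using assms unfolding fps_X_power_dvd_iff_nth by (auto simp: fps_X_mult_nth)

text \<open>This is Frobenius: the off-diagonal products in the convolution cancel in pairs. Odd
  coefficients vanish because a square has derivative 0.\<close>

lemma fps_square_nth_bit:
  fixes f :: "bit fps"
  shows "fps_nth (f\<^sup>2) k = (if even k then fps_nth f (k div 2) else 0)"
proof (cases "even k")
  case False
  then obtain j where k: "k = Suc (2 * j)" by (auto elim!: oddE)
  have "fps_deriv (f\<^sup>2) = 0"
    by (simp add: power2_eq_square mult.commute fps_eq_iff numeral_fps_const)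
  then have "fps_nth (fps_deriv (f\<^sup>2)) (2 * j) = 0" by simp
  then show ?thesis using k by (simp add: of_nat_bit)
next
  case True
  then obtain j where k: "k = 2 * j" by blast
  let ?g = "\<lambda>i. fps_nth f i * fps_nth f (2 * j - i)"
  have "sum ?g {0..2 * j} = sum ?g {0..<j} + sum ?g {j..2 * j}"
    by (subst sum.union_disjoint[symmetric]) (auto intro!: sum.cong)
  also have "sum ?g {j..2 * j} = ?g j + sum ?g {Suc j..2 * j}"
    by (rule sum.atLeast_Suc_atMost) simp
  also have "sum ?g {Suc j..2 * j} = sum ?g {0..<j}"
    by (rule sum.reindex_bij_witness[of _ "\<lambda>i. 2 * j - i" "\<lambda>i. 2 * j - i"])
       (auto simp: mult.commute)
  finally have "sum ?g {0..2 * j} = fps_nth f j"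
    by (simp add: ac_simps)
  then show ?thesis using k by (simp add: power2_eq_square fps_mult_nth)
qed

section \<open>The Riccati equation and its rational approximations\<close>

definition riccati :: "bit fps \<Rightarrow> bit fps" where
  "riccati f = (fps_X + fps_X\<^sup>2) * fps_deriv f + f + 1 + fps_X\<^sup>2 * f\<^sup>2"

text \<open>Coefficient \<open>k\<close> of \<open>x f'\<close> is \<open>k\<close> times that of
  \<open>f\<close>, so \<open>x f' + f\<close> keeps only even coefficients; \<open>x^2 f'\<close>
  and \<open>x^2 f^2\<close> contribute only at even \<open>k\<close> as well. At
  \<open>k = 2 * j + 2\<close> what remains is the defect of the recurrence.\<close>

lemma riccati_nth:
  "fps_nth (riccati f) k =
     (if k = 0 then fps_nth f 0 + 1
      else if even k then fps_nth f k + fps_nth f (k - 1) + fps_nth f (k div 2 - 1) else 0)"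
proof (cases k)
  case (Suc j)
  show ?thesis
  proof (cases j)
    case 0
    then show ?thesis using Suc
      by (simp add: riccati_def distrib_right fps_X_power_mult_nth power2_eq_square mult.assoc)
  next
    case (Suc i)
    have "k = Suc (Suc i)" using Suc \<open>k = Suc j\<close> by simp
    then show ?thesis
      by (auto simp: riccati_def distrib_right fps_X_power_mult_nth fps_square_nth_bit
          of_nat_bit add.assoc)
  qed
qed (simp add: riccati_def distrib_right fps_X_power_mult_nth)

text \<open>At \<open>x = 1\<close> the derivative terms vanish, and \<open>a\<^sup>2 + a b + b\<^sup>2\<close> is anisotropic over the field
  with two elements; so \<open>u\<close> and \<open>v\<close> are divisible by \<open>x - 1\<close>, and one descends.\<close>

lemma riccati_no_rational_solution:
  fixes u v :: "bit poly"
  assumes "([:0, 1:] + [:0, 1:]\<^sup>2) * (v * pderiv u - pderiv v * u) + v * u + v\<^sup>2 + [:0, 1:]\<^sup>2 * u\<^sup>2 = 0"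
  shows "v = 0"
  using assms
proof (induction "degree v" arbitrary: u v rule: less_induct)
  case less
  show ?case
  proof (rule ccontr)
    assume "v \<noteq> 0"
    have "poly (([:0, 1:] + [:0, 1:]\<^sup>2) * (v * pderiv u - pderiv v * u) + v * u + v\<^sup>2
        + [:0, 1:]\<^sup>2 * u\<^sup>2) 1 = 0"
      by (subst less.prems) simp
    then have "poly u 1 = 0 \<and> poly v 1 = 0"
      by (cases "poly u 1"; cases "poly v 1") (auto simp: power2_eq_square)
    then obtain u' v' where uv: "u = [:-1, 1:] * u'" "v = [:-1, 1:] * v'"
      by (auto simp: poly_eq_0_iff_dvd dvd_def)
    \<comment> \<open>The terms with \<open>p'\<close> cancel in the Wronskian, so a common factor
      of \<open>u\<close> and \<open>v\<close> comes out squared.\<close>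
    have factor: "(x + x\<^sup>2) * ((p * b) * (p * a' + a * p') - (p * b' + b * p') * (p * a)) + (p * b) * (p * a)
        + (p * b)\<^sup>2 + x\<^sup>2 * (p * a)\<^sup>2
        = p\<^sup>2 * ((x + x\<^sup>2) * (b * a' - b' * a) + b * a + b\<^sup>2 + x\<^sup>2 * a\<^sup>2)"
      for a b a' b' p p' x :: "bit poly"
      by (simp add: algebra_simps power2_eq_square)
    have "[:-1, 1:]\<^sup>2 * (([:0, 1:] + [:0, 1:]\<^sup>2) * (v' * pderiv u' - pderiv v' * u') + v' * u'
        + v'\<^sup>2 + [:0, 1:]\<^sup>2 * u'\<^sup>2) = 0"
      using less.prems unfolding uv pderiv_mult factor .
    then have eq: "([:0, 1:] + [:0, 1:]\<^sup>2) * (v' * pderiv u' - pderiv v' * u') + v' * u'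
        + v'\<^sup>2 + [:0, 1:]\<^sup>2 * u'\<^sup>2 = 0"
      by (simp only: mult_eq_0_iff power_eq_0_iff) simp
    have "v' \<noteq> 0" using \<open>v \<noteq> 0\<close> uv by auto
    then have "degree v = Suc (degree v')"
      unfolding uv by (subst degree_mult_eq) auto
    then show False using less.hyps[OF _ eq] \<open>v' \<noteq> 0\<close> by simp
  qed
qed

lemma degree_pderiv_le_diff: "degree (pderiv p) \<le> degree p - 1"
  by (rule degree_le) (auto simp: coeff_pderiv coeff_eq_0)

text \<open>Clearing denominators with \<open>v^2\<close> and substituting
  \<open>v f = u + e\<close> leaves an error in which \<open>e'\<close> occurs only as
  \<open>x * e'\<close>; hence differentiating \<open>e\<close> costs no precision.\<close>

lemma riccati_homogenized:
  fixes x f f' u u' v v' e e' :: "'a::comm_ring_1"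
  assumes vf: "v * f = u + e" and vf': "v * f' + v' * f = u' + e'"
  shows "(x + x\<^sup>2) * (v * u' - v' * u) + v * u + v\<^sup>2 + x\<^sup>2 * u\<^sup>2
    = v\<^sup>2 * ((x + x\<^sup>2) * f' + f + 1 + x\<^sup>2 * f\<^sup>2)
      - ((1 + x) * v * (x * e') + e * (v + x\<^sup>2 * e + 2 * x\<^sup>2 * u - (x + x\<^sup>2) * v'))"
proof -
  have "v * f' = u' + e' - v' * f" using vf' by (simp add: algebra_simps)
  then have "v * (v * f') = v * (u' + e' - v' * f)" by (rule arg_cong)
  also have "\<dots> = v * (u' + e') - v' * (v * f)" by (simp add: algebra_simps)
  finally have vvf': "v * (v * f') = v * (u' + e') - v' * (u + e)" by (simp add: vf)
  have "v\<^sup>2 * ((x + x\<^sup>2) * f' + f + 1 + x\<^sup>2 * f\<^sup>2)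
      = (x + x\<^sup>2) * (v * (v * f')) + v * (v * f) + v\<^sup>2 + x\<^sup>2 * (v * f)\<^sup>2"
    by (simp add: algebra_simps power2_eq_square)
  then show ?thesis unfolding vvf' unfolding vf by (simp add: algebra_simps power2_eq_square)
qed

text \<open>The homogenized expression \<open>l\<close> vanishes up to \<open>x^(2m)\<close> by
  precision, yet has degree at most \<open>2 * m\<close>, so it is 0. The alternative
  \<open>u = 0\<close> makes room for \<open>m = 0\<close>.\<close>

lemma riccati_convergent:
  fixes f e :: "bit fps" and u v :: "bit poly"
  assumes ric: "fps_X ^ (2 * m + 1) dvd riccati f"
    and e: "fps_X ^ (2 * m + 1) dvd e" and eq: "fps_of_poly v * f = fps_of_poly u + e"
    and v: "degree v \<le> m" and u: "u = 0 \<or> degree u < m"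
  shows "v = 0"
proof -
  define l where "l = ([:0, 1:] + [:0, 1:]\<^sup>2) * (v * pderiv u - pderiv v * u) + v * u + v\<^sup>2
    + [:0, 1:]\<^sup>2 * u\<^sup>2"
  let ?X = "fps_X :: bit fps" and ?v = "fps_of_poly v" and ?u = "fps_of_poly u"
  have X: "fps_of_poly [:0, 1:] = ?X" by (simp add: fps_of_poly_pCons)
  have l: "fps_of_poly l = (?X + ?X\<^sup>2) * (?v * fps_deriv ?u - fps_deriv ?v * ?u) + ?v * ?u + ?v\<^sup>2
      + ?X\<^sup>2 * ?u\<^sup>2"
    unfolding l_def fps_of_poly_add fps_of_poly_mult fps_of_poly_diff fps_of_poly_power
      fps_of_poly_pderiv X ..
  have "fps_deriv (?v * f) = fps_deriv (?u + e)" using eq by simp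
  then have deq: "?v * fps_deriv f + fps_deriv ?v * f = fps_deriv ?u + fps_deriv e" by simp
  have "fps_of_poly l = ?v\<^sup>2 * riccati f
      - ((1 + ?X) * ?v * (?X * fps_deriv e)
         + e * (?v + ?X\<^sup>2 * e + 2 * ?X\<^sup>2 * ?u - (?X + ?X\<^sup>2) * fps_deriv ?v))"
    unfolding l riccati_def using eq deq by (rule riccati_homogenized)
  also have "?X ^ (2 * m + 1) dvd \<dots>"
    by (intro dvd_diff dvd_add dvd_mult dvd_mult2 ric e fps_X_power_dvd_X_mult_deriv)
  finally have low: "coeff l i = 0" if "i \<le> 2 * m" for i
    using that unfolding fps_X_power_dvd_iff_nth by simp
  have "degree l \<le> 2 * m"
  proof (cases "u = 0")
    case True
    then show ?thesis using v degree_power_le[of v 2] by (simp add: l_def)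
  next
    case False
    then have um: "degree u < m" using u by simp
    have d: "degree (v * pderiv u - pderiv v * u) \<le> 2 * m - 2"
    proof (rule degree_diff_le)
      show "degree (v * pderiv u) \<le> 2 * m - 2"
      \<comment> \<open>For constant \<open>u\<close> the truncated bound
        \<open>degree u - 1 = 0\<close> would be too weak when \<open>m = 1\<close>, but then
        \<open>pderiv u = 0\<close>.\<close>
      proof (cases "degree u = 0")
        case True
        then obtain a where "u = [:a:]" by (rule degree_eq_zeroE)
        then show ?thesis by (simp add: pderiv_pCons)
      next
        case False
        then show ?thesis
          using degree_mult_le[of v "pderiv u"] um v degree_pderiv_le_diff[of u] by linarith
      qed
      show "degree (pderiv v * u) \<le> 2 * m - 2"
        using degree_mult_le[of "pderiv v" u] um v degree_pderiv_le_diff[of v] by linarith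
    qed
    have "degree ([:0, 1:] + [:0, 1:]\<^sup>2 :: bit poly) \<le> 2"
      by (simp add: power2_eq_square)
    then have "degree (([:0, 1:] + [:0, 1:]\<^sup>2) * (v * pderiv u - pderiv v * u)) \<le> 2 * m"
      using d um by (intro order.trans[OF degree_mult_le]) linarith
    moreover have "degree (v * u) \<le> 2 * m"
      using um v by (intro order.trans[OF degree_mult_le]) linarith
    moreover have "degree (v\<^sup>2) \<le> 2 * m"
      using v by (intro order.trans[OF degree_power_le]) simp
    moreover have "degree ([:0, 1:]\<^sup>2 * u\<^sup>2) \<le> 2 * m"
      using um by (intro order.trans[OF degree_mult_le] order.trans[OF add_mono[OF degree_power_le degree_power_le]]) simp
    ultimately show ?thesis unfolding l_def by (intro degree_add_le) auto
  qed
  then have "l = 0"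
    using low by (metis leading_coeff_0_iff)
  then show ?thesis unfolding l_def by (rule riccati_no_rational_solution)
qed

section \<open>Hankel determinants and the recurrence\<close>

abbreviation hankel_mat :: "(nat \<Rightarrow> 'a) \<Rightarrow> nat \<Rightarrow> 'a mat" where
  "hankel_mat s n \<equiv> mat n n (\<lambda>(i, j). s (i + j))"

text \<open>A kernel vector would be the denominator of a Pade approximant that is too good. The
  recurrence is assumed only for terms occurring in the matrix, as the inductive converse
  requires.\<close>

lemma det_hankel_mat_eq_1:
  fixes s :: "nat \<Rightarrow> bit"
  assumes s0: "s 0 = 1" and rec: "\<And>k. k + 2 \<le> n \<Longrightarrow> s (2 * k + 2) = s (2 * k + 1) + s k"
  shows "det (hankel_mat s n) = 1"
proof (cases n)
  case 0
  then show ?thesis by (simp add: det_dim_zero)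
next
  case (Suc m)
  have "det (hankel_mat s n) \<noteq> 0"
  proof
    assume "det (hankel_mat s n) = 0"
    then obtain w where w: "w \<in> carrier_vec n" "w \<noteq> 0\<^sub>v n" "hankel_mat s n *\<^sub>v w = 0\<^sub>v n"
      using det_0_iff_vec_prod_zero_field[of "hankel_mat s n" n] by auto
    have ker: "(\<Sum>j = 0..m. s (i + j) * w $ j) = 0" if "i \<le> m" for i
    proof -
      have "(hankel_mat s n *\<^sub>v w) $ i = 0" using w(3) that Suc by simp
      then show ?thesis using that Suc w(1)
        by (simp add: scalar_prod_def atLeastLessThanSuc_atLeastAtMost)
    qed
    define f where "f = Abs_fps s"
    \<comment> \<open>Reversing \<open>w\<close> turns its products with the rows of the matrix into
      the coefficients \<open>m\<close> to \<open>2 * m\<close> of \<open>v f\<close>; the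
      coefficients below \<open>m\<close> form the numerator \<open>u\<close>.\<close>
    define v where "v = truncate_fps (Suc m) (Abs_fps (\<lambda>i. w $ (m - i)))"
    define u where "u = truncate_fps m (fps_of_poly v * f)"
    define e where "e = fps_of_poly v * f - fps_of_poly u"
    have vf: "fps_nth (fps_of_poly v * f) i = 0" if i: "m \<le> i" "i \<le> 2 * m" for i
    proof -
      have "fps_nth (fps_of_poly v * f) i = (\<Sum>k = 0..i. coeff v k * s (i - k))"
        by (simp add: fps_mult_nth f_def)
      also have "\<dots> = (\<Sum>k = 0..m. coeff v k * s (i - k))"
        using i by (intro sum.mono_neutral_right) (auto simp: v_def coeff_truncate_fps)
      also have "\<dots> = (\<Sum>j = 0..m. s (i - m + j) * w $ j)"
        using i by (intro sum.reindex_bij_witness[of _ "\<lambda>j. m - j" "\<lambda>j. m - j"])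
          (auto simp: v_def coeff_truncate_fps mult.commute)
      also have "\<dots> = 0" using i by (intro ker) simp
      finally show ?thesis .
    qed
    have "v = 0"
    proof (rule riccati_convergent)
      show "fps_X ^ (2 * m + 1) dvd riccati f"
        unfolding fps_X_power_dvd_iff_nth
      proof (intro allI impI)
        fix i assume i: "i < 2 * m + 1"
        show "fps_nth (riccati f) i = 0"
        proof (cases "i = 0 \<or> odd i")
          case True
          then show ?thesis using s0 by (auto simp: riccati_nth f_def)
        next
          case False
          then obtain k where k: "i = 2 * k + 2"
            by (metis evenE add.commute mult_Suc_right nat.exhaust mult_0_right)
          then show ?thesis using rec[of k] i Suc by (simp add: riccati_nth f_def)
        qed
      qed
      show "fps_X ^ (2 * m + 1) dvd e"
        unfolding fps_X_power_dvd_iff_nth using vf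
        by (auto simp: e_def u_def coeff_truncate_fps)
      show "fps_of_poly v * f = fps_of_poly u + e" by (simp add: e_def)
      show "degree v \<le> m"
        by (rule degree_le) (simp add: v_def coeff_truncate_fps)
      show "u = 0 \<or> degree u < m"
      proof (cases "u = 0")
        case False
        then have "coeff u (degree u) \<noteq> 0" by simp
        then show ?thesis by (auto simp: u_def coeff_truncate_fps split: if_splits)
      qed simp
    qed
    have "w $ j = 0" if "j < n" for j
    proof -
      have "coeff v (m - j) = w $ j" using that Suc by (simp add: v_def coeff_truncate_fps)
      then show ?thesis using \<open>v = 0\<close> by simp
    qed
    then have "w = 0\<^sub>v n" using w(1) by (intro eq_vecI) auto
    then show False using w(2) by simp
  qed
  then show ?thesis by simp
qed

text \<open>The term \<open>s (2 * n)\<close> occurs only in the bottom right corner, whose cofactor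
  is the determinant of order \<open>n\<close>.\<close>

lemma det_hankel_mat_corner:
  fixes s :: "nat \<Rightarrow> 'a::comm_ring_1"
  shows "det (hankel_mat (s(2 * n := a)) (Suc n)) - det (hankel_mat s (Suc n))
    = (a - s (2 * n)) * det (hankel_mat s n)"
proof -
  let ?t = "s(2 * n := a)"
  have del: "mat_delete (hankel_mat ?t (Suc n)) n j = mat_delete (hankel_mat s (Suc n)) n j" if "j \<le> n" for j
    using that by (intro eq_matI) (auto simp: mat_delete_def)
  have "mat_delete (hankel_mat s (Suc n)) n n = hankel_mat s n"
    by (intro eq_matI) (auto simp: mat_delete_def)
  then have cof: "cofactor (hankel_mat s (Suc n)) n n = det (hankel_mat s n)"
    by (simp add: cofactor_def flip: mult_2)
  have "det (hankel_mat ?t (Suc n))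
      = (\<Sum>j<Suc n. hankel_mat ?t (Suc n) $$ (n, j) * cofactor (hankel_mat ?t (Suc n)) n j)"
    by (rule laplace_expansion_row) auto
  also have "\<dots> = (\<Sum>j<Suc n. ?t (n + j) * cofactor (hankel_mat s (Suc n)) n j)"
    unfolding cofactor_def by (intro sum.cong refl) (simp add: del less_Suc_eq_le del: fun_upd_apply)
  finally have "det (hankel_mat ?t (Suc n)) = \<dots>" .
  moreover have "det (hankel_mat s (Suc n)) = (\<Sum>j<Suc n. s (n + j) * cofactor (hankel_mat s (Suc n)) n j)"
    by (subst laplace_expansion_row[where i = n and n = "Suc n"]) (auto intro!: sum.cong)
  ultimately show ?thesis by (simp add: cof left_diff_distrib flip: mult_2)
qed

lemma det_hankel_mat_bit_iff:
  fixes s :: "nat \<Rightarrow> bit"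
  shows "(\<forall>n. det (hankel_mat s n) = 1) \<longleftrightarrow>
    s 0 = 1 \<and> (\<forall>k. s (2 * k + 2) = s (2 * k + 1) + s k)"
proof
  assume "s 0 = 1 \<and> (\<forall>k. s (2 * k + 2) = s (2 * k + 1) + s k)"
  then show "\<forall>n. det (hankel_mat s n) = 1" using det_hankel_mat_eq_1[of s] by simp
next
  assume det: "\<forall>n. det (hankel_mat s n) = 1"
  have "det (hankel_mat s 1) = 1" using det by blast
  then have s0: "s 0 = 1" by (simp add: det_single)
  have "s (2 * k + 2) = s (2 * k + 1) + s k" for k
  proof (induction k rule: less_induct)
    case (less k)
    \<comment> \<open>Changing the last corner entry alone would change the determinant.\<close>
    define a where "a = s (2 * k + 1) + s k"
    let ?t = "s(2 * (k + 1) := a)"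
    have "det (hankel_mat ?t (Suc (k + 1))) = 1"
    proof (rule det_hankel_mat_eq_1)
      fix i assume "i + 2 \<le> Suc (k + 1)"
      then show "?t (2 * i + 2) = ?t (2 * i + 1) + ?t i"
        using less[of i] by (cases "i = k") (auto simp: a_def; presburger)+
    qed (simp add: s0)
    then have "a - s (2 * (k + 1)) = 0"
      using det_hankel_mat_corner[where s = s and n = "k + 1" and a = a] det by simp
    then show ?case by (simp add: a_def)
  qed
  then show "s 0 = 1 \<and> (\<forall>k. s (2 * k + 2) = s (2 * k + 1) + s k)" using s0 by blast
qed

section \<open>Row and column operations, and reduction modulo 2\<close>

lemma det_row_differences:
  fixes f :: "nat \<Rightarrow> nat \<Rightarrow> 'a::comm_ring_1"
  shows "det (mat n n (\<lambda>(i, j). if i = 0 then f 0 j else f i j - f (i - 1) j))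
    = det (mat n n (\<lambda>(i, j). f i j))"
proof -
  let ?P = "mat n n (\<lambda>(i, j). if i = j then 1 else if i = Suc j then - 1 else 0) :: 'a mat"
  let ?F = "mat n n (\<lambda>(i, j). f i j)"
  have "det ?P = 1"
    by (subst det_lower_triangular[of n]) (auto simp: prod_list_diag_prod)
  moreover have "mat n n (\<lambda>(i, j). if i = 0 then f 0 j else f i j - f (i - 1) j) = ?P * ?F"
  proof (rule eq_matI)
    fix i j assume "i < dim_row (?P * ?F)" "j < dim_col (?P * ?F)"
    then have ij: "i < n" "j < n" by auto
    have "(?P * ?F) $$ (i, j) = (\<Sum>k = 0..<n. (if i = k then 1 else if i = Suc k then - 1 else 0) * f k j)"
      using ij by (simp add: scalar_prod_def)
    \<comment> \<open>At \<open>i = 0\<close> the index \<open>i - 1\<close> truncates to 0, so the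
      subtracted term must be zeroed explicitly.\<close>
    also have "\<dots> = (\<Sum>k = 0..<n. (if k = i then f k j else 0)
        - (if k = i - 1 then if i = 0 then 0 else f k j else 0))"
      by (intro sum.cong) auto
    also have "\<dots> = (if i = 0 then f 0 j else f i j - f (i - 1) j)"
      using ij by (simp add: sum_subtractf)
    finally show "mat n n (\<lambda>(i, j). if i = 0 then f 0 j else f i j - f (i - 1) j) $$ (i, j) =
        (?P * ?F) $$ (i, j)"
      using ij by simp
  qed auto
  ultimately show ?thesis by (simp add: det_mult[of _ n])
qed

lemma det_col_differences:
  fixes f :: "nat \<Rightarrow> nat \<Rightarrow> 'a::comm_ring_1"
  shows "det (mat n n (\<lambda>(i, j). if j = 0 then f i 0 else f i j - f i (j - 1)))
    = det (mat n n (\<lambda>(i, j). f i j))"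
proof -
  have tr: "det (mat n n (\<lambda>(i, j). g i j)) = det (mat n n (\<lambda>(i, j). g j i))"
    for g :: "nat \<Rightarrow> nat \<Rightarrow> 'a"
    by (subst det_transpose[symmetric, of _ n]) (auto intro!: arg_cong[of _ _ det] eq_matI)
  show ?thesis
    using det_row_differences[of n "\<lambda>i j. f j i"]
      tr[of "\<lambda>i j. f i j"] tr[of "\<lambda>i j. if j = 0 then f i 0 else f i j - f i (j - 1)"]
    by simp
qed

lemma det_scale_rows:
  fixes f :: "nat \<Rightarrow> nat \<Rightarrow> 'a::comm_ring_1"
  shows "det (mat n n (\<lambda>(i, j). c i * f i j)) = (\<Prod>i<n. c i) * det (mat n n (\<lambda>(i, j). f i j))"
proof -
  let ?D = "mat n n (\<lambda>(i, j). if i = j then c i else 0)"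
  let ?F = "mat n n (\<lambda>(i, j). f i j)"
  have "det ?D = (\<Prod>i<n. c i)"
    by (subst det_lower_triangular[of n]) (auto simp: prod_list_diag_prod atLeast0LessThan)
  moreover have "mat n n (\<lambda>(i, j). c i * f i j) = ?D * ?F"
    by (rule eq_matI) (auto simp: scalar_prod_def if_distrib[of "\<lambda>x. x * _"] cong: if_cong)
  ultimately show ?thesis by (simp add: det_mult[of _ n])
qed

lemma det_first_row_unit:
  fixes f :: "nat \<Rightarrow> nat \<Rightarrow> 'a::comm_ring_1"
  assumes "f 0 0 = 1" "\<And>j. 0 < j \<Longrightarrow> j \<le> n \<Longrightarrow> f 0 j = 0"
  shows "det (mat (Suc n) (Suc n) (\<lambda>(i, j). f i j)) = det (mat n n (\<lambda>(i, j). f (Suc i) (Suc j)))"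
proof -
  let ?A = "mat (Suc n) (Suc n) (\<lambda>(i, j). f i j)"
  have "det ?A = (\<Sum>j<Suc n. ?A $$ (0, j) * cofactor ?A 0 j)"
    by (rule laplace_expansion_row) auto
  also have "\<dots> = (\<Sum>j<Suc n. if j = 0 then cofactor ?A 0 0 else 0)"
    by (rule sum.cong) (auto simp: assms)
  also have "\<dots> = det (mat_delete ?A 0 0)" by (simp add: cofactor_def)
  also have "mat_delete ?A 0 0 = mat n n (\<lambda>(i, j). f (Suc i) (Suc j))"
    by (rule eq_matI) (auto simp: mat_delete_def)
  finally show ?thesis .
qed

text \<open>Row differences make all \<open>n\<close> rows after the first even, which accounts for
  \<open>2 ^ n\<close>. Modulo 2 the first row is then all ones, so column differences make it a
  unit vector and turn the entries of the remaining minor into sums of consecutive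
  \<open>c\<close>.\<close>

lemma hankel_det_mod_2:
  fixes d :: "nat \<Rightarrow> int"
  assumes d: "\<forall>n. d n \<in> {-1, 1}"
  defines "c \<equiv> \<lambda>k. of_int ((d (Suc k) - d k) div 2) :: bit"
  shows "of_int (hankel_det d (Suc n) div 2 ^ n) = det (hankel_mat (\<lambda>k. c k + c (Suc k)) n)"
proof -
  define g where "g i j = (if i = 0 then d j else (d (i + j) - d (i - 1 + j)) div 2)" for i j
  have odd: "odd (d k)" for k using d[rule_format, of k] by auto
  have "hankel_det d (Suc n) = det (mat (Suc n) (Suc n)
      (\<lambda>(i, j). if i = 0 then d (0 + j) else d (i + j) - d (i - 1 + j)))"
    unfolding hankel_det_def by (rule det_row_differences[symmetric])
  also have "\<dots> = det (mat (Suc n) (Suc n) (\<lambda>(i, j). (if i = 0 then 1 else 2) * g i j))"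
    by (intro arg_cong[of _ _ det] eq_matI) (auto simp: g_def odd)
  also have "\<dots> = 2 ^ n * det (mat (Suc n) (Suc n) (\<lambda>(i, j). g i j))"
    by (subst det_scale_rows) (simp only: prod.lessThan_Suc_shift, simp)
  finally have "of_int (hankel_det d (Suc n) div 2 ^ n) =
      (of_int (det (mat (Suc n) (Suc n) (\<lambda>(i, j). g i j))) :: bit)" by simp
  also have "\<dots> = det (map_mat of_int (mat (Suc n) (Suc n) (\<lambda>(i, j). g i j)))"
    by simp
  also have "map_mat of_int (mat (Suc n) (Suc n) (\<lambda>(i, j). g i j)) =
      mat (Suc n) (Suc n) (\<lambda>(i, j). if i = 0 then 1 else c (i - 1 + j))"
    using odd by (intro eq_matI) (auto simp: g_def c_def of_int_bit_eq_1_iff)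
  also have "det \<dots> = det (mat (Suc n) (Suc n) (\<lambda>(i, j).
      if j = 0 then if i = 0 then 1 else c (i - 1 + 0)
      else (if i = 0 then 1 else c (i - 1 + j)) - (if i = 0 then 1 else c (i - 1 + (j - 1)))))"
    by (rule det_col_differences[symmetric])
  also have "\<dots> = det (hankel_mat (\<lambda>k. c k + c (Suc k)) n)"
    by (subst det_first_row_unit) (auto simp: bit_minus_eq_add add.commute)
  finally show ?thesis .
qed

section \<open>Translation back to sign sequences\<close>

theorem theorem1p1:
  fixes d :: "nat \<Rightarrow> int"
  assumes "\<forall>n. d n \<in> {-1, 1}"
  shows "apwenian d \<longleftrightarrow>
    (\<forall>n\<ge>0. [(d n + d (n + 1) - d (2 * n + 1) - d (2 * n + 2)) div 2 = 1] (mod 2))"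
proof -
  define c where "c = (\<lambda>k. of_int ((d (Suc k) - d k) div 2) :: bit)"
  define s where "s = (\<lambda>k. c k + c (Suc k))"
  have cong: "[k = 1] (mod 2) \<longleftrightarrow> (of_int k :: bit) = 1" for k :: int
    by (simp add: of_int_bit_eq_1_iff cong_def odd_iff_mod_2_eq_one)
  \<comment> \<open>Half of \<open>d n + d (n + 1)\<close> is \<open>d n\<close> plus half of
    \<open>d (n + 1) - d n\<close>, and likewise at \<open>2 * n + 1\<close>; the odd terms
    \<open>d n\<close> and \<open>d (2 * n + 1)\<close> cancel modulo 2.\<close>
  have cond: "[(d n + d (n + 1) - d (2 * n + 1) - d (2 * n + 2)) div 2 = 1] (mod 2)
      \<longleftrightarrow> c n + c (2 * n + 1) = 1" for n
  proof -
    have "d n \<in> {-1, 1}" "d (n + 1) \<in> {-1, 1}" "d (2 * n + 1) \<in> {-1, 1}" "d (2 * n + 2) \<in> {-1, 1}"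
      using assms by blast+
    then show ?thesis unfolding cong c_def by auto
  qed
  have "apwenian d \<longleftrightarrow> (\<forall>n. (of_int (hankel_det d (Suc n) div 2 ^ n) :: bit) = 1)"
    using assms unfolding apwenian_def cong by (auto simp: Suc_le_eq gr0_conv_Suc)
  also have "\<dots> \<longleftrightarrow> (\<forall>n. det (hankel_mat s n) = 1)"
    using hankel_det_mod_2[OF assms] by (simp add: s_def c_def)
  also have "\<dots> \<longleftrightarrow> s 0 = 1 \<and> (\<forall>k. s (2 * k + 2) = s (2 * k + 1) + s k)"
    by (rule det_hankel_mat_bit_iff)
  \<comment> \<open>With \<open>t n = c n + c (2 * n + 1)\<close>, the recurrence at
    \<open>n\<close> reads \<open>t n = t (n + 1)\<close> because \<open>c (2 * n + 2)\<close>
    cancels, and \<open>s 0 = t 0\<close>; so it says that \<open>t\<close> is constantly 1.\<close>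
  also have "\<dots> \<longleftrightarrow> (\<forall>n. c n + c (2 * n + 1) = 1)"
  proof
    assume s: "s 0 = 1 \<and> (\<forall>k. s (2 * k + 2) = s (2 * k + 1) + s k)"
    have "c n + c (2 * n + 1) = 1" for n
    proof (induction n)
      case 0
      then show ?case using s by (simp add: s_def)
    next
      case (Suc n)
      have "s (2 * n + 2) = s (2 * n + 1) + s n" using s by blast
      then show ?case using Suc
        by (cases "c n"; cases "c (Suc n)"; cases "c (2 * n + 1)"; cases "c (2 * n + 2)";
            cases "c (2 * n + 3)") (auto simp: s_def numeral_3_eq_3)
    qed
    then show "\<forall>n. c n + c (2 * n + 1) = 1" ..
  next
    assume c: "\<forall>n. c n + c (2 * n + 1) = 1"
    have "s (2 * k + 2) = s (2 * k + 1) + s k" for k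
      using c[rule_format, of k] c[rule_format, of "Suc k"]
      by (cases "c k"; cases "c (Suc k)"; cases "c (2 * k + 1)"; cases "c (2 * k + 2)";
            cases "c (2 * k + 3)") (auto simp: s_def numeral_3_eq_3)
    then show "s 0 = 1 \<and> (\<forall>k. s (2 * k + 2) = s (2 * k + 1) + s k)"
      using c[rule_format, of 0] by (simp add: s_def)
  qed
  finally show ?thesis using cond by simp
qed

end
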